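(* If $V$ is an object of the category $\mathcal{A}_1$ (defined in the context), then there exist a left quasigroup $(G,* )$ satisfying $$(a*c)\backslash_G((a*b)*c)=(a'*c)\backslash_G((a'*b)*c)\quad(\forall a,a',b,c\in G)$$ and a bijection $\pi':L_V\to G$ such that $V=[(L_V,(G,\mu^G_1),\pi')]$, where $\mu^G_1(a,b,c)=a*(b\backslash_G c)$ $(a,b,c\in G)$.
   Context: A left quasigroup $(L,\cdot)$ is a nonempty set $L$ with a binary operation such that for all $u,w\in L$ there is a unique $v\in L$ with $u\cdot v=w$; this $v$ is denoted $u\backslash_L w$ (similarly $\backslash_G$ for $(G,* )$). A ternary system $(M,\mu)$ is a nonempty set $M$ with a map $\mu:M^3\to M$; a homomorphism $h:(M,\mu)\to(M',\mu')$ is a map with $h(\mu(a,b,c))=\mu'(h(a),h(b),h(c))$ for all $a,b,c$. Let $LMB$ be the collection of all triplets $(L,M,\pi)$ where $L$ is a left quasigroup, $M=(M,\mu)$ is a ternary system satisfying, for all $a,b,c,d\in M$, $$\mu(a,\mu(a,b,c),\mu(\mu(a,b,c),c,d))=\mu(a,b,\mu(b,c,d)),$$ $$\mu(\mu(a,b,c),c,d)=\mu(\mu(a,b,\mu(b,c,d)),\mu(b,c,d),d),$$ and $\pi:L\to M$ is a bijection. Write $(L,M,\pi)\sim(L',M',\pi')$ iff $L=L'$ as left quasigroups and $\pi'\pi^{-1}:M\to M'$ is a homomorphism of ternary systems (an equivalence relation). Objects of the category $\mathcal{A}$ are the equivalence classes $[(L,M,\pi)]$; $L_V$ denotes the common left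 quasigroup of all representatives of $V$. $V$ is an object of $\mathcal{A}_1$ iff it is an object of $\mathcal{A}$ having a representative $(L,(M,\mu),\pi)$ such that $\mu(a,b,\mu(b,c,d))=\mu(a,c,d)$ and $\mu(a,a,b)=b$ for all $a,b,c,d\in M$. *)

theory Defs
  imports "HOL-Algebra.Congruence" "HOL-Library.FuncSet"
begin

text \<open>
  Structures are given by a carrier set inside an ambient type. All maps are extensional
  (\<open>\<rightarrow>\<^sub>E\<close>), so that HOL equality of structures is equality of carriers and of operations on them.
\<close>

record 'a magma = "'a partial_object" +
  op :: "'a \<Rightarrow> 'a \<Rightarrow> 'a" (infixl \<open>\<cdot>\<index>\<close> 70)

record 'b ternary = "'b partial_object" +
  tern :: "'b \<Rightarrow> 'b \<Rightarrow> 'b \<Rightarrow> 'b"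

definition left_quasigroup :: "'a magma \<Rightarrow> bool" where
  "left_quasigroup L \<longleftrightarrow>
     carrier L \<noteq> {} \<and>
     op L \<in> carrier L \<rightarrow>\<^sub>E carrier L \<rightarrow>\<^sub>E carrier L \<and>
     (\<forall>u\<in>carrier L. \<forall>w\<in>carrier L. \<exists>!v. v \<in> carrier L \<and> u \<cdot>\<^bsub>L\<^esub> v = w)"

definition ldiv :: "'a magma \<Rightarrow> 'a \<Rightarrow> 'a \<Rightarrow> 'a" where
  "ldiv L u w = (THE v. v \<in> carrier L \<and> u \<cdot>\<^bsub>L\<^esub> v = w)"

definition ternary_system :: "'b ternary \<Rightarrow> bool" where
  "ternary_system M \<longleftrightarrow>
     carrier M \<noteq> {} \<and>
     tern M \<in> carrier M \<rightarrow>\<^sub>E carrier M \<rightarrow>\<^sub>E carrier M \<rightarrow>\<^sub>E carrier M"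

definition ternary_hom :: "'b ternary \<Rightarrow> 'c ternary \<Rightarrow> ('b \<Rightarrow> 'c) set" where
  "ternary_hom M M' = {h. h \<in> carrier M \<rightarrow> carrier M' \<and>
     (\<forall>a\<in>carrier M. \<forall>b\<in>carrier M. \<forall>c\<in>carrier M.
        h (tern M a b c) = tern M' (h a) (h b) (h c))}"

definition LMB :: "('a magma \<times> 'b ternary \<times> ('a \<Rightarrow> 'b)) set" where
  "LMB = {(L, M, p).
     left_quasigroup L \<and> ternary_system M \<and>
     (\<forall>a\<in>carrier M. \<forall>b\<in>carrier M. \<forall>c\<in>carrier M. \<forall>d\<in>carrier M.
        tern M a (tern M a b c) (tern M (tern M a b c) c d) = tern M a b (tern M b c d)) \<and>
     (\<forall>a\<in>carrier M. \<forall>b\<in>carrier M. \<forall>c\<in>carrier M. \<forall>d\<in>carrier M.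
        tern M (tern M a b c) c d
          = tern M (tern M a b (tern M b c d)) (tern M b c d) d) \<and>
     p \<in> carrier L \<rightarrow>\<^sub>E carrier M \<and> bij_betw p (carrier L) (carrier M)}"

definition lmb_equiv ::
  "(('a magma \<times> 'b ternary \<times> ('a \<Rightarrow> 'b)) \<times> ('a magma \<times> 'b ternary \<times> ('a \<Rightarrow> 'b))) set" where
  "lmb_equiv = {((L, M, p), (L', M', p')).
     (L, M, p) \<in> LMB \<and> (L', M', p') \<in> LMB \<and> L = L' \<and>
     p' \<circ> inv_into (carrier L) p \<in> ternary_hom M M'}"

text \<open>
  \<open>lmb_class x\<close> is empty when \<open>x \<notin> LMB\<close>. Hence \<open>V = lmb_class x\<close> for an object \<open>V\<close>
  entails \<open>x \<in> LMB\<close>.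
\<close>

definition lmb_class ::
  "('a magma \<times> 'b ternary \<times> ('a \<Rightarrow> 'b)) \<Rightarrow> ('a magma \<times> 'b ternary \<times> ('a \<Rightarrow> 'b)) set" where
  "lmb_class x = lmb_equiv `` {x}"

definition objects_A :: "('a magma \<times> 'b ternary \<times> ('a \<Rightarrow> 'b)) set set" where
  "objects_A = LMB // lmb_equiv"

definition lqg_of :: "('a magma \<times> 'b ternary \<times> ('a \<Rightarrow> 'b)) set \<Rightarrow> 'a magma" where
  "lqg_of V = (THE L. \<exists>M p. (L, M, p) \<in> V)"

definition objects_A1 :: "('a magma \<times> 'b ternary \<times> ('a \<Rightarrow> 'b)) set set" where
  "objects_A1 = {V \<in> objects_A. \<exists>L M p. (L, M, p) \<in> V \<and>
     (\<forall>a\<in>carrier M. \<forall>b\<in>carrier M. \<forall>c\<in>carrier M. \<forall>d\<in>carrier M.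
        tern M a b (tern M b c d) = tern M a c d) \<and>
     (\<forall>a\<in>carrier M. \<forall>b\<in>carrier M. tern M a a b = b)}"

definition mu1 :: "'b magma \<Rightarrow> 'b ternary" where
  "mu1 G = \<lparr>carrier = carrier G,
     tern = (\<lambda>a\<in>carrier G. \<lambda>b\<in>carrier G. \<lambda>c\<in>carrier G. a \<cdot>\<^bsub>G\<^esub> ldiv G b c)\<rparr>"

lemma equiv_lmb_equiv:
  "equiv (LMB :: ('a magma \<times> 'b ternary \<times> ('a \<Rightarrow> 'b)) set) lmb_equiv"
  (is "equiv ?A ?r")
proof (rule equivI)
  show "?r \<subseteq> ?A \<times> ?A" by (auto simp: lmb_equiv_def)
  show "refl_on ?A ?r"
  proof (rule refl_onI, unfold split_paired_all)
    fix L :: "'a magma" and M :: "'b ternary" and p :: "'a \<Rightarrow> 'b"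
    assume x: "(L, M, p) \<in> LMB"
    then have b: "bij_betw p (carrier L) (carrier M)" and ts: "ternary_system M"
      by (auto simp: LMB_def)
    have cl: "tern M a b c \<in> carrier M"
      if "a \<in> carrier M" "b \<in> carrier M" "c \<in> carrier M" for a b c
      using ts that by (auto simp: ternary_system_def PiE_iff)
    have "p \<circ> inv_into (carrier L) p \<in> ternary_hom M M"
      using b by (simp add: ternary_hom_def Pi_iff bij_betw_inv_into_right cl)
    then show "((L, M, p), L, M, p) \<in> lmb_equiv"
      using x by (simp add: lmb_equiv_def)
  qed
  show "sym ?r"
  proof (rule symI, unfold split_paired_all)
    fix L L' :: "'a magma" and M M' :: "'b ternary" and p p' :: "'a \<Rightarrow> 'b"
    assume r: "((L, M, p), L', M', p') \<in> lmb_equiv"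
    define h where "h = p' \<circ> inv_into (carrier L) p"
    define k where "k = p \<circ> inv_into (carrier L) p'"
    have L: "L' = L" and in1: "(L, M, p) \<in> LMB" and in2: "(L, M', p') \<in> LMB"
      and h: "h \<in> ternary_hom M M'"
      using r by (auto simp: lmb_equiv_def h_def)
    have b: "bij_betw p (carrier L) (carrier M)" "bij_betw p' (carrier L) (carrier M')"
      and ts: "ternary_system M"
      using in1 in2 by (auto simp: LMB_def)
    have kM: "k x \<in> carrier M" if "x \<in> carrier M'" for x
      using that b by (auto simp: k_def bij_betw_def inv_into_into)
    have hk: "h (k x) = x" if "x \<in> carrier M'" for x
      using that b by (auto simp: h_def k_def bij_betw_def f_inv_into_f inv_into_into)
    have kh: "k (h x) = x" if "x \<in> carrier M" for x
      using that b by (auto simp: h_def k_def bij_betw_def f_inv_into_f inv_into_into)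
    have cl: "tern M a b c \<in> carrier M"
      if "a \<in> carrier M" "b \<in> carrier M" "c \<in> carrier M" for a b c
      using ts that by (auto simp: ternary_system_def PiE_iff)
    have "k (tern M' a b c) = tern M (k a) (k b) (k c)"
      if abc: "a \<in> carrier M'" "b \<in> carrier M'" "c \<in> carrier M'" for a b c
    proof -
      have "tern M' a b c = h (tern M (k a) (k b) (k c))"
        using h abc by (simp add: ternary_hom_def kM hk)
      then show ?thesis using abc by (simp add: kh cl kM)
    qed
    then have "k \<in> ternary_hom M' M" using kM by (auto simp: ternary_hom_def)
    then show "((L', M', p'), L, M, p) \<in> lmb_equiv"
      using L in1 in2 by (simp add: lmb_equiv_def k_def)
  qed
  show "trans ?r"
  proof (rule transI, unfold split_paired_all)
    fix L L' L'' :: "'a magma" and M M' M'' :: "'b ternary" and p p' p'' :: "'a \<Rightarrow> 'b"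
    assume r: "((L, M, p), L', M', p') \<in> lmb_equiv"
      and s: "((L', M', p'), L'', M'', p'') \<in> lmb_equiv"
    define h where "h = p' \<circ> inv_into (carrier L) p"
    define k where "k = p'' \<circ> inv_into (carrier L) p'"
    have L: "L' = L" "L'' = L"
      and in1: "(L, M, p) \<in> LMB" and in2: "(L, M', p') \<in> LMB" and in3: "(L, M'', p'') \<in> LMB"
      and h: "h \<in> ternary_hom M M'" and k: "k \<in> ternary_hom M' M''"
      using r s by (auto simp: lmb_equiv_def h_def k_def)
    have b: "bij_betw p (carrier L) (carrier M)" "bij_betw p' (carrier L) (carrier M')"
      and ts: "ternary_system M"
      using in1 in2 by (auto simp: LMB_def)
    have cl: "tern M a b c \<in> carrier M"
      if "a \<in> carrier M" "b \<in> carrier M" "c \<in> carrier M" for a b c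
      using ts that by (auto simp: ternary_system_def PiE_iff)
    have eq: "(p'' \<circ> inv_into (carrier L) p) x = k (h x)" if "x \<in> carrier M" for x
      using that b by (simp add: h_def k_def bij_betw_def inv_into_into)
    have "p'' \<circ> inv_into (carrier L) p \<in> ternary_hom M M''"
      using h k eq cl by (simp add: ternary_hom_def Pi_iff del: comp_apply)
    then show "((L, M, p), L'', M'', p'') \<in> lmb_equiv"
      using L in1 in3 by (simp add: lmb_equiv_def)
  qed
qed

lemma lqg_of_eq:
  assumes "V \<in> objects_A" "(L, M, p) \<in> V"
  shows "lqg_of V = L"
proof -
  have "L' = L" if "(L', M', p') \<in> V" for L' M' p'
    using assms that by (auto simp: objects_A_def lmb_equiv_def elim!: quotientE)
  then show ?thesis unfolding lqg_of_def using assms(2) by blast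
qed

end

theory Submission
  imports Defs
begin

text \<open>
  Read \<open>\<mu>(a,b,-)\<close> as a map \<open>\<Lambda>\<^sub>a\<^sub>b\<close> of \<open>M\<close> into itself. The two identities that define \<open>\<A>\<^sub>1\<close> say
  \<open>\<Lambda>\<^sub>a\<^sub>b \<Lambda>\<^sub>b\<^sub>c = \<Lambda>\<^sub>a\<^sub>c\<close> and \<open>\<Lambda>\<^sub>a\<^sub>a = id\<close>: the family \<open>\<Lambda>\<close> is a cocycle on pairs of points, with values in the
  permutations of \<open>M\<close>. Hence, for any base point \<open>e\<close>, it is the coboundary
  \<open>\<Lambda>\<^sub>a\<^sub>b = \<phi>\<^sub>a \<phi>\<^sub>b\<^sup>-\<^sup>1\<close> of \<open>\<phi>\<^sub>a = \<Lambda>\<^sub>a\<^sub>e\<close>. Taking \<open>\<phi>\<^sub>a\<close> as left translation by \<open>a\<close>, that is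
  \<open>a * b = \<mu>(a,e,b)\<close>, makes \<open>M\<close> a left quasigroup \<open>G\<close> with \<open>u \ w = \<mu>(e,u,w)\<close>, and the coboundary
  formula says exactly that \<open>\<mu>(a,b,c) = a * (b \ c)\<close>. So \<open>\<mu>\<close> is literally \<open>\<mu>\<^sup>G\<^sub>1\<close>
  (lemma \<open>mu1_based_magma\<close>), and the bijection of the given representative serves unchanged.

  Under the cocycle identity, the second law of \<open>LMB\<close> becomes
  \<open>\<mu>(\<mu>(a,b,c),c,d) = \<mu>(\<mu>(a,c,d),\<mu>(b,c,d),d)\<close>. Written in terms of \<open>\<phi>\<close>, this is
  the independence of \<open>(a * c) \ ((a * b) * c)\<close> from \<open>a\<close> (lemma \<open>ldiv_based_magma_indep\<close>).
\<close>

lemma left_quasigroupI: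
  assumes "carrier G \<noteq> {}" "op G \<in> carrier G \<rightarrow>\<^sub>E carrier G \<rightarrow>\<^sub>E carrier G"
    and "\<And>u w. u \<in> carrier G \<Longrightarrow> w \<in> carrier G \<Longrightarrow> r u w \<in> carrier G"
    and "\<And>u w. u \<in> carrier G \<Longrightarrow> w \<in> carrier G \<Longrightarrow> u \<cdot>\<^bsub>G\<^esub> r u w = w"
    and "\<And>u v. u \<in> carrier G \<Longrightarrow> v \<in> carrier G \<Longrightarrow> r u (u \<cdot>\<^bsub>G\<^esub> v) = v"
  shows "left_quasigroup G"
  unfolding left_quasigroup_def using assms by metis

lemma ldiv_eqI:
  assumes "left_quasigroup G" "u \<in> carrier G" "v \<in> carrier G" "u \<cdot>\<^bsub>G\<^esub> v = w"
  shows "ldiv G u w = v"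
proof -
  have "w \<in> carrier G"
    using assms by (auto simp: left_quasigroup_def PiE_iff)
  with assms show ?thesis
    unfolding ldiv_def left_quasigroup_def by (blast intro: the1_equality)
qed

definition based_magma :: "'b ternary \<Rightarrow> 'b \<Rightarrow> 'b magma" where
  "based_magma M e = \<lparr>carrier = carrier M,
     op = (\<lambda>a\<in>carrier M. \<lambda>b\<in>carrier M. tern M a e b)\<rparr>"

lemma carrier_based_magma [simp]: "carrier (based_magma M e) = carrier M"
  by (simp add: based_magma_def)

lemma op_based_magma [simp]:
  "a \<in> carrier M \<Longrightarrow> b \<in> carrier M \<Longrightarrow> a \<cdot>\<^bsub>based_magma M e\<^esub> b = tern M a e b"
  by (simp add: based_magma_def)

locale ternary_cocycle =
  fixes M :: "'b ternary"
  assumes ternary_system: "ternary_system M"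
    and cocycle: "\<lbrakk>a \<in> carrier M; b \<in> carrier M; c \<in> carrier M; d \<in> carrier M\<rbrakk>
          \<Longrightarrow> tern M a b (tern M b c d) = tern M a c d"
    and tern_same: "\<lbrakk>a \<in> carrier M; b \<in> carrier M\<rbrakk> \<Longrightarrow> tern M a a b = b"
begin

lemma tern_closed [simp, intro]:
  "\<lbrakk>a \<in> carrier M; b \<in> carrier M; c \<in> carrier M\<rbrakk> \<Longrightarrow> tern M a b c \<in> carrier M"
  using ternary_system by (auto simp: ternary_system_def PiE_iff)

text \<open>
  The cocycle identity with equal outer indices makes \<open>\<mu>(e,u,-)\<close> a two-sided inverse of the left
  translation \<open>\<mu>(u,e,-)\<close>.
\<close>

lemma left_quasigroup_based_magma:
  assumes "e \<in> carrier M"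
  shows "left_quasigroup (based_magma M e)"
proof (rule left_quasigroupI[where r = "tern M e"])
  show "op (based_magma M e) \<in> carrier (based_magma M e) \<rightarrow>\<^sub>E carrier (based_magma M e)
          \<rightarrow>\<^sub>E carrier (based_magma M e)"
    using assms by (auto simp: based_magma_def)
qed (use assms in \<open>auto simp: cocycle tern_same\<close>)

lemma ldiv_based_magma:
  assumes "e \<in> carrier M" "u \<in> carrier M" "w \<in> carrier M"
  shows "ldiv (based_magma M e) u w = tern M e u w"
  using assms by (intro ldiv_eqI left_quasigroup_based_magma) (simp_all add: cocycle tern_same)

lemma mu1_based_magma:
  assumes "e \<in> carrier M"
  shows "mu1 (based_magma M e) = M"
proof -
  have extl: "tern M \<in> carrier M \<rightarrow>\<^sub>E carrier M \<rightarrow>\<^sub>E carrier M \<rightarrow>\<^sub>E carrier M"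
    using ternary_system by (simp add: ternary_system_def)
  have "tern (mu1 (based_magma M e)) a b c = tern M a b c" for a b c
  proof (cases "a \<in> carrier M \<and> b \<in> carrier M \<and> c \<in> carrier M")
    case True
    with assms show ?thesis
      by (simp add: mu1_def ldiv_based_magma cocycle)
  next
    case False
    \<comment> \<open>Off the carrier, extensionality forces the same default value on both operations.\<close>
    with extl show ?thesis
      by (auto simp: mu1_def restrict_def PiE_iff extensional_def)
  qed
  then have "tern (mu1 (based_magma M e)) = tern M"
    by (simp add: fun_eq_iff)
  then show ?thesis
    by (intro ternary.equality) (simp_all add: mu1_def)
qed

text \<open>
  In the second law of \<open>LMB\<close>, replace \<open>a,b,c,d\<close> by \<open>a\<close>, \<open>a'\<close>, \<open>a' * b\<close> and \<open>(a' * b) * c\<close>.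
  The cocycle identity collapses it to \<open>(a * b) * c = \<mu>(a * c, a' * c, (a' * b) * c)\<close>, whose
  right-hand side is \<open>(a * c) * ((a' * c) \ ((a' * b) * c))\<close>.
\<close>

lemma ldiv_based_magma_indep:
  fixes e
  defines "G \<equiv> based_magma M e"
  assumes law: "\<And>a b c d. \<lbrakk>a \<in> carrier M; b \<in> carrier M; c \<in> carrier M; d \<in> carrier M\<rbrakk>
      \<Longrightarrow> tern M (tern M a b c) c d = tern M (tern M a b (tern M b c d)) (tern M b c d) d"
    and e: "e \<in> carrier M"
    and abc: "a \<in> carrier M" "a' \<in> carrier M" "b \<in> carrier M" "c \<in> carrier M"
  shows "ldiv G (a \<cdot>\<^bsub>G\<^esub> c) ((a \<cdot>\<^bsub>G\<^esub> b) \<cdot>\<^bsub>G\<^esub> c) = ldiv G (a' \<cdot>\<^bsub>G\<^esub> c) ((a' \<cdot>\<^bsub>G\<^esub> b) \<cdot>\<^bsub>G\<^esub> c)"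
proof -
  define g where "g = tern M a' e b"
  define d where "d = tern M g e c"
  have gd: "g \<in> carrier M" "d \<in> carrier M"
    using e abc by (simp_all add: g_def d_def)
  have "tern M (tern M a e b) e c = tern M (tern M a a' g) g d"
    using e abc gd(1) by (simp add: g_def d_def cocycle)
  also have "\<dots> = tern M (tern M a g d) (tern M a' g d) d"
    using law[of a a' g d] abc gd by (simp add: cocycle)
  also have "\<dots> = tern M (tern M a e c) (tern M a' e c) d"
    using e abc gd(1) by (simp add: d_def cocycle)
  finally have "tern M e (tern M a e c) (tern M (tern M a e b) e c)
      = tern M e (tern M a' e c) d"
    using e abc gd by (simp add: cocycle)
  then show ?thesis
    using e abc by (simp add: G_def ldiv_based_magma g_def d_def)
qed

end

theorem proposition6p10:
  fixes V :: "('a magma \<times> 'b ternary \<times> ('a \<Rightarrow> 'b)) set"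
  assumes "V \<in> objects_A1"
  shows "\<exists>(G :: 'b magma) (p' :: 'a \<Rightarrow> 'b).
    left_quasigroup G \<and>
    (\<forall>a\<in>carrier G. \<forall>a'\<in>carrier G. \<forall>b\<in>carrier G. \<forall>c\<in>carrier G.
       ldiv G (a \<cdot>\<^bsub>G\<^esub> c) ((a \<cdot>\<^bsub>G\<^esub> b) \<cdot>\<^bsub>G\<^esub> c) = ldiv G (a' \<cdot>\<^bsub>G\<^esub> c) ((a' \<cdot>\<^bsub>G\<^esub> b) \<cdot>\<^bsub>G\<^esub> c)) \<and>
    bij_betw p' (carrier (lqg_of V)) (carrier G) \<and>
    V = lmb_class (lqg_of V, mu1 G, p')"
proof -
  obtain L M p where V: "V \<in> objects_A" and rep: "(L, M, p) \<in> V"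
    and A1: "\<forall>a\<in>carrier M. \<forall>b\<in>carrier M. \<forall>c\<in>carrier M. \<forall>d\<in>carrier M.
        tern M a b (tern M b c d) = tern M a c d"
      "\<forall>a\<in>carrier M. \<forall>b\<in>carrier M. tern M a a b = b"
    using assms unfolding objects_A1_def by blast
  have in_LMB: "(L, M, p) \<in> LMB"
    using V rep in_quotient_imp_subset[OF equiv_lmb_equiv] unfolding objects_A_def by blast
  have V_eq: "V = lmb_class (L, M, p)"
    using V rep unfolding objects_A_def lmb_class_def
    by (metis equiv_lmb_equiv quotientE Image_singleton_iff equiv_class_eq)
  have bij: "bij_betw p (carrier L) (carrier M)"
    using in_LMB by (simp add: LMB_def)
  have ts: "ternary_system M"
    and law: "\<And>a b c d. \<lbrakk>a \<in> carrier M; b \<in> carrier M; c \<in> carrier M; d \<in> carrier M\<rbrakk>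
      \<Longrightarrow> tern M (tern M a b c) c d = tern M (tern M a b (tern M b c d)) (tern M b c d) d"
    using in_LMB by (simp_all add: LMB_def)
  interpret ternary_cocycle M
    using ts A1 by unfold_locales auto
  obtain e where e: "e \<in> carrier M"
    using ts by (auto simp: ternary_system_def)
  show ?thesis
  proof (intro exI conjI ballI)
    show "left_quasigroup (based_magma M e)"
      by (rule left_quasigroup_based_magma[OF e])
    show "bij_betw p (carrier (lqg_of V)) (carrier (based_magma M e))"
      using bij by (simp add: lqg_of_eq[OF V rep])
    show "V = lmb_class (lqg_of V, mu1 (based_magma M e), p)"
      unfolding lqg_of_eq[OF V rep] mu1_based_magma[OF e] by (rule V_eq)
  qed (rule ldiv_based_magma_indep[OF law e]; simp)
qed

end
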